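(* For every positive integer $n$, the maximum number of copies of $C_4$ in an $n$-vertex bipartite graph containing no copy of $C_6$ is $\binom{n-2}{2}$, i.e. \[ \mathrm{ex}_{bip}(n,C_4,C_6)=\binom{n-2}{2}, \] and the only $n$-vertex $C_6$-free bipartite graph attaining this maximum is $K_{2,n-2}$.
   Context: $C_k$ denotes the cycle on $k$ vertices and $K_{a,b}$ the complete bipartite graph with parts of sizes $a$ and $b$. A copy of $H$ in $G$ is a (not necessarily induced) subgraph of $G$ isomorphic to $H$; $G$ is $F$-free if it contains no copy of $F$. $\mathrm{ex}_{bip}(n,H,F)$ denotes the maximum number of copies of $H$ over all $n$-vertex bipartite $F$-free graphs.
   Formalization: Uniqueness of K_{2,n-2} is claimed only for n ≥ 4: for n = 2, 3 every n-vertex bipartite graph attains the maximum 0 (e.g. the edgeless graph and K_2 for n = 2), and for n = 1 K_{2,n-2} is undefined; the binomial coefficient is read as 0 at n = 1. *)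

theory Defs
  imports Complex_Main
begin

text \<open>A graph is a pair of a vertex set and an edge set, edges being two-element sets of
  vertices.\<close>

type_synonym 'a sgraph = "'a set \<times> 'a set set"

abbreviation verts :: "'a sgraph \<Rightarrow> 'a set" where "verts G \<equiv> fst G"
abbreviation edges :: "'a sgraph \<Rightarrow> 'a set set" where "edges G \<equiv> snd G"

definition simple_graph :: "'a sgraph \<Rightarrow> bool" where
  "simple_graph G \<longleftrightarrow>
     finite (verts G) \<and> (\<forall>e\<in>edges G. e \<subseteq> verts G \<and> card e = 2)"

definition subgraph :: "'a sgraph \<Rightarrow> 'a sgraph \<Rightarrow> bool" where
  "subgraph S G \<longleftrightarrow> simple_graph S \<and> verts S \<subseteq> verts G \<and> edges S \<subseteq> edges G"

definition isomorphic :: "'a sgraph \<Rightarrow> 'b sgraph \<Rightarrow> bool" where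
  "isomorphic G H \<longleftrightarrow>
     (\<exists>f. bij_betw f (verts G) (verts H) \<and>
          (\<forall>u\<in>verts G. \<forall>v\<in>verts G. {u, v} \<in> edges G \<longleftrightarrow> {f u, f v} \<in> edges H))"

text \<open>A copy is a subgraph as such, not an embedding: automorphisms of \<open>H\<close> do not
  contribute to the number of copies.\<close>

definition copies :: "'h sgraph \<Rightarrow> 'a sgraph \<Rightarrow> 'a sgraph set" where
  "copies H G = {S. subgraph S G \<and> isomorphic H S}"

definition free_of :: "'h sgraph \<Rightarrow> 'a sgraph \<Rightarrow> bool" where
  "free_of F G \<longleftrightarrow> copies F G = {}"

text \<open>A part may be empty.\<close>

definition bipartite :: "'a sgraph \<Rightarrow> bool" where
  "bipartite G \<longleftrightarrow>
     (\<exists>A B. A \<union> B = verts G \<and> A \<inter> B = {} \<and>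
            (\<forall>e\<in>edges G. \<exists>a\<in>A. \<exists>b\<in>B. e = {a, b}))"

text \<open>A cycle only for \<open>k \<ge> 3\<close>.\<close>

definition cycle_graph :: "nat \<Rightarrow> nat sgraph" where
  "cycle_graph k = ({..<k}, {{i, Suc i mod k} | i. i < k})"

definition complete_bipartite :: "nat \<Rightarrow> nat \<Rightarrow> (nat + nat) sgraph" where
  "complete_bipartite a b =
     ({..<a} <+> {..<b}, {{Inl i, Inr j} | i j. i < a \<and> j < b})"

definition bip_free_graph :: "nat \<Rightarrow> 'f sgraph \<Rightarrow> 'a sgraph \<Rightarrow> bool" where
  "bip_free_graph n F G \<longleftrightarrow>
     simple_graph G \<and> card (verts G) = n \<and> bipartite G \<and> free_of F G"

text \<open>Every finite graph is isomorphic to one with natural numbers as vertices, so it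
  suffices to range over those.\<close>

definition ex_bip :: "nat \<Rightarrow> 'h sgraph \<Rightarrow> 'f sgraph \<Rightarrow> nat" where
  "ex_bip n H F = Max {card (copies H G) | G :: nat sgraph. bip_free_graph n F G}"

end

theory Submission imports Defs begin

text \<open>
  In a bipartite \<open>C\<^sub>6\<close>-free graph the two diagonals of a 4-cycle \<open>a b c d\<close> cannot both have codegree
  at least 3: a further common neighbour \<open>b'\<close> of \<open>a, c\<close> and a further common neighbour \<open>a'\<close> of
  \<open>b, d\<close> give the 6-cycle \<open>a b' c d a' b\<close>.  So every 4-cycle is determined by one of its diagonals,
  a pair of codegree exactly 2 inside a part, and there are at most \<open>(p choose 2) + (q choose 2)\<close>
  4-cycles if the parts have sizes \<open>p\<close> and \<open>q\<close>.  If \<open>p, q \<ge> 3\<close>, then some pair does not have codegree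
  2: otherwise three vertices \<open>x, y, z\<close> of one part would have pairwise common neighbourhoods of
  size 2, which either admit distinct representatives, giving a 6-cycle, or coincide, giving a pair
  of codegree at least 3.  Hence the count is less than \<open>(p choose 2) + (q choose 2)\<close>, which is at
  most \<open>(p + q - 2) choose 2\<close>.  If \<open>p = 2\<close>, the count is \<open>k choose 2\<close> with \<open>k \<le> q\<close> the codegree of the
  two vertices of the small part.
\<close>

section \<open>Copies as images of injective maps\<close>

text \<open>As \<open>S\<close> is simple, each of its edges joins two values of \<open>f\<close>,
  so the adjacency equivalence determines all of \<open>edges S\<close>. Conversely, an injection
  creates no extra adjacency in its image. Copies and freeness thus become statements about
  edge-preserving injections.\<close>

lemma copies_eq:
  assumes H: "simple_graph H" and G: "simple_graph G"
  shows "copies H G = {(f ` verts H, (`) f ` edges H) | f.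
    inj_on f (verts H) \<and> f ` verts H \<subseteq> verts G \<and> (`) f ` edges H \<subseteq> edges G}" (is "_ = ?R")
proof (intro equalityI subsetI)
  fix S assume "S \<in> copies H G"
  then have S: "simple_graph S" "verts S \<subseteq> verts G" "edges S \<subseteq> edges G" and "isomorphic H S"
    by (auto simp: copies_def subgraph_def)
  then obtain f where f: "bij_betw f (verts H) (verts S)"
    and adj: "\<And>u v. u \<in> verts H \<Longrightarrow> v \<in> verts H \<Longrightarrow> {u, v} \<in> edges H \<longleftrightarrow> {f u, f v} \<in> edges S"
    unfolding isomorphic_def by blast
  have vs: "verts S = f ` verts H" using f by (simp add: bij_betw_def)
  have "edges S = (`) f ` edges H"
  proof (intro equalityI subsetI)
    fix e assume e: "e \<in> edges S"
    then have "e \<subseteq> f ` verts H" "card e = 2" using S vs by (auto simp: simple_graph_def)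
    then obtain u v where "e = {f u, f v}" "u \<in> verts H" "v \<in> verts H"
      by (auto simp: card_2_iff)
    then have "{u, v} \<in> edges H" "e = f ` {u, v}" using adj e by auto
    then show "e \<in> (`) f ` edges H" by blast
  next
    fix e assume "e \<in> (`) f ` edges H"
    then obtain d where d: "d \<in> edges H" "e = f ` d" by blast
    then have "d \<subseteq> verts H" "card d = 2" using H by (auto simp: simple_graph_def)
    then obtain u v where "d = {u, v}" "u \<in> verts H" "v \<in> verts H" by (auto simp: card_2_iff)
    then show "e \<in> edges S" using adj d by auto
  qed
  moreover have "inj_on f (verts H)" using f by (simp add: bij_betw_def)
  ultimately show "S \<in> ?R" using S vs by (auto intro!: exI[of _ f] prod_eqI)
next
  fix S assume "S \<in> ?R"
  then obtain f where S: "S = (f ` verts H, (`) f ` edges H)"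
    and f: "inj_on f (verts H)" "f ` verts H \<subseteq> verts G" "(`) f ` edges H \<subseteq> edges G" by blast
  have sub: "e \<subseteq> verts H" if "e \<in> edges H" for e using H that by (auto simp: simple_graph_def)
  have "simple_graph S"
    using H f(1) S by (auto simp: simple_graph_def card_image inj_on_subset)
  moreover have "{u, v} \<in> edges H \<longleftrightarrow> {f u, f v} \<in> (`) f ` edges H"
    if "u \<in> verts H" "v \<in> verts H" for u v
  proof
    assume "{f u, f v} \<in> (`) f ` edges H"
    then obtain e where e: "e \<in> edges H" "f ` e = f ` {u, v}" by auto
    then have "e = {u, v}"
      using inj_on_image_eq_iff[OF f(1) sub[OF e(1)], of "{u, v}"] that by auto
    with e show "{u, v} \<in> edges H" by simp
  qed (auto intro: image_eqI[of _ _ "{u, v}"])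
  then have "isomorphic H S"
    using f(1) S by (auto simp: isomorphic_def bij_betw_def intro!: exI[of _ f])
  ultimately show "S \<in> copies H G"
    using S f by (auto simp: copies_def subgraph_def)
qed

section \<open>The cycles of length 4 and 6 written out\<close>

lemma edges_cycle_graph_4: "edges (cycle_graph 4) = {{0, 1}, {1, 2}, {2, 3}, {3, 0}}"
proof -
  have "edges (cycle_graph 4) = (\<lambda>i. {i, (i + 1) mod 4}) ` {..<4}"
    by (auto simp: cycle_graph_def)
  also have "{..<4::nat} = {0, 1, 2, 3}" by auto
  finally show ?thesis by (simp del: One_nat_def)
qed

lemma edges_cycle_graph_6:
  "edges (cycle_graph 6) = {{0, 1}, {1, 2}, {2, 3}, {3, 4}, {4, 5}, {5, 0}}"
proof -
  have "edges (cycle_graph 6) = (\<lambda>i. {i, (i + 1) mod 6}) ` {..<6}"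
    by (auto simp: cycle_graph_def)
  also have "{..<6::nat} = {0, 1, 2, 3, 4, 5}" by auto
  finally show ?thesis by (simp del: One_nat_def)
qed

lemma verts_cycle_graph_4: "verts (cycle_graph 4) = {0, 1, 2, 3}"
  by (auto simp: cycle_graph_def)

lemma verts_cycle_graph_6: "verts (cycle_graph 6) = {0, 1, 2, 3, 4, 5}"
  by (auto simp: cycle_graph_def)

lemma simple_graph_cycle_graph_4: "simple_graph (cycle_graph 4)"
  unfolding simple_graph_def edges_cycle_graph_4 verts_cycle_graph_4 by simp

lemma simple_graph_cycle_graph_6: "simple_graph (cycle_graph 6)"
  unfolding simple_graph_def edges_cycle_graph_6 verts_cycle_graph_6 by simp

section \<open>Bipartitions\<close>

text \<open>The parts that \<open>bipartite\<close> merely asserts to exist are named here, since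
  the counting depends on the part in which a pair lies.\<close>

definition bipartition :: "'a sgraph \<Rightarrow> 'a set \<Rightarrow> 'a set \<Rightarrow> bool" where
  "bipartition G A B \<longleftrightarrow> simple_graph G \<and> A \<union> B = verts G \<and> A \<inter> B = {} \<and>
     (\<forall>e\<in>edges G. \<exists>a\<in>A. \<exists>b\<in>B. e = {a, b})"

definition join :: "'a set \<Rightarrow> 'a set \<Rightarrow> 'a sgraph" where
  "join X Y = (X \<union> Y, {{x, y} | x y. x \<in> X \<and> y \<in> Y})"

text \<open>\<open>X\<close> and \<open>Y\<close> are the two diagonals of a 4-cycle; placing
  \<open>X\<close> in \<open>A\<close> and \<open>Y\<close> in \<open>B\<close> represents each
  cycle by a single ordered pair.\<close>

definition rects :: "'a sgraph \<Rightarrow> 'a set \<Rightarrow> 'a set \<Rightarrow> ('a set \<times> 'a set) set" where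
  "rects G A B = {(X, Y). X \<subseteq> A \<and> Y \<subseteq> B \<and> card X = 2 \<and> card Y = 2 \<and>
     (\<forall>x\<in>X. \<forall>y\<in>Y. {x, y} \<in> edges G)}"

text \<open>For empty \<open>X\<close> this is the whole type, whence the condition
  \<open>X \<noteq> {}\<close> in \<open>common_nbrs_subset\<close>.\<close>

definition common_nbrs :: "'a sgraph \<Rightarrow> 'a set \<Rightarrow> 'a set" where
  "common_nbrs G X = {v. \<forall>x\<in>X. {x, v} \<in> edges G}"

definition pairs_codeg_2 :: "'a sgraph \<Rightarrow> 'a set \<Rightarrow> 'a set set" where
  "pairs_codeg_2 G A = {X. X \<subseteq> A \<and> card X = 2 \<and> card (common_nbrs G X) = 2}"

lemma bipartition_sym: "bipartition G A B \<Longrightarrow> bipartition G B A"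
  unfolding bipartition_def by (metis Int_commute Un_commute insert_commute)

lemma join_commute: "join X Y = join Y X"
  unfolding join_def by (auto simp: insert_commute)

lemma bipartition_finite:
  assumes "bipartition G A B"
  shows "finite A" "finite B"
  using assms unfolding bipartition_def simple_graph_def by (metis finite_Un)+

lemma bipartition_card: "bipartition G A B \<Longrightarrow> card (verts G) = card A + card B"
  using bipartition_finite[of G A B] unfolding bipartition_def by (metis card_Un_disjoint)

lemma bipartition_nbr:
  assumes "bipartition G A B" "{u, v} \<in> edges G" "u \<in> A"
  shows "v \<in> B"
  using assms unfolding bipartition_def by (fastforce simp: doubleton_eq_iff)

lemma bipartition_edge_verts:
  assumes "bipartition G A B" "{u, v} \<in> edges G"
  shows "u \<in> A \<union> B" "v \<in> A \<union> B"
  using assms unfolding bipartition_def simple_graph_def by auto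

lemma common_nbrs_subset:
  assumes "bipartition G A B" "X \<subseteq> A" "X \<noteq> {}"
  shows "common_nbrs G X \<subseteq> B"
  using assms bipartition_nbr[OF assms(1)] unfolding common_nbrs_def by blast

section \<open>4-cycles as pairs of diagonals\<close>

lemma rects_subset_copies_C4:
  assumes b: "bipartition G A B" and r: "(X, Y) \<in> rects G A B"
  shows "join X Y \<in> copies (cycle_graph 4) G"
proof -
  obtain x x' where X: "X = {x, x'}" "x \<noteq> x'" using r by (auto simp: rects_def card_2_iff)
  obtain y y' where Y: "Y = {y, y'}" "y \<noteq> y'" using r by (auto simp: rects_def card_2_iff)
  have e: "{x, y} \<in> edges G" "{x, y'} \<in> edges G" "{x', y} \<in> edges G" "{x', y'} \<in> edges G"
    and AB: "x \<in> A" "x' \<in> A" "y \<in> B" "y' \<in> B"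
    using r X Y by (auto simp: rects_def)
  have ne: "x \<noteq> y" "x \<noteq> y'" "x' \<noteq> y" "x' \<noteq> y'" using b AB by (auto simp: bipartition_def)
  \<comment> \<open>The cyclic order alternates between the two diagonals.\<close>
  define f :: "nat \<Rightarrow> 'a" where "f i = [x, y, x', y'] ! i" for i
  have f: "f 0 = x" "f 1 = y" "f (Suc 0) = y" "f 2 = x'" "f 3 = y'"
    by (simp_all add: f_def numeral_2_eq_2 numeral_3_eq_3)
  have "join X Y = (f ` verts (cycle_graph 4), (`) f ` edges (cycle_graph 4))"
    unfolding join_def verts_cycle_graph_4 edges_cycle_graph_4
    using X Y by (auto simp: f doubleton_eq_iff)
  moreover have "inj_on f (verts (cycle_graph 4))"
    using X Y ne by (auto simp: verts_cycle_graph_4 f)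
  moreover have "f ` verts (cycle_graph 4) \<subseteq> verts G"
    using AB b by (auto simp: verts_cycle_graph_4 f bipartition_def)
  moreover have "(`) f ` edges (cycle_graph 4) \<subseteq> edges G"
    unfolding edges_cycle_graph_4 using e by (auto simp: f insert_commute)
  moreover have "simple_graph G" using b by (simp add: bipartition_def)
  ultimately show ?thesis
    unfolding copies_eq[OF simple_graph_cycle_graph_4 \<open>simple_graph G\<close>] by blast
qed

text \<open>The parts alternate along a 4-cycle, so each diagonal lies inside one part, and the
  edges are exactly the pairs between the two diagonals.\<close>

lemma copies_C4_bipartition:
  assumes b: "bipartition G A B"
  shows "copies (cycle_graph 4) G = (\<lambda>(X, Y). join X Y) ` rects G A B"
proof (intro equalityI subsetI)
  fix S assume "S \<in> copies (cycle_graph 4) G"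
  moreover have "simple_graph G" using b by (simp add: bipartition_def)
  ultimately obtain f :: "nat \<Rightarrow> 'a" where
    S: "S = (f ` verts (cycle_graph 4), (`) f ` edges (cycle_graph 4))"
    and inj: "inj_on f (verts (cycle_graph 4))"
    and "(`) f ` edges (cycle_graph 4) \<subseteq> edges G"
    using copies_eq[OF simple_graph_cycle_graph_4] by blast
  then have e: "{f 0, f 1} \<in> edges G" "{f 1, f 2} \<in> edges G"
    "{f 2, f 3} \<in> edges G" "{f 3, f 0} \<in> edges G"
    unfolding edges_cycle_graph_4 by auto
  have ne: "f 0 \<noteq> f 2" "f 1 \<noteq> f 3" using inj by (auto simp: verts_cycle_graph_4)
  have Sj: "S = join {f 0, f 2} {f 1, f 3}"
    unfolding S join_def verts_cycle_graph_4 edges_cycle_graph_4 by auto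
  \<comment> \<open>Both orders of the parts are covered, as \<open>f 0\<close> may lie in
    \<open>A\<close> or in \<open>B\<close>.\<close>
  have key: "({f 0, f 2}, {f 1, f 3}) \<in> rects G C D" if "bipartition G C D" "f 0 \<in> C" for C D
  proof -
    note nbr = bipartition_nbr[OF that(1)] bipartition_nbr[OF bipartition_sym[OF that(1)]]
    have "f 1 \<in> D" using nbr(1)[OF e(1) that(2)] .
    moreover have "f 2 \<in> C" using nbr(2)[OF e(2) calculation] .
    moreover have "f 3 \<in> D" using nbr(1)[OF e(3) calculation(2)] .
    ultimately show ?thesis using that e ne by (auto simp: rects_def insert_commute)
  qed
  from bipartition_edge_verts[OF b e(1)] consider "f 0 \<in> A" | "f 0 \<in> B" by blast
  then show "S \<in> (\<lambda>(X, Y). join X Y) ` rects G A B"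
  proof cases
    case 1
    then show ?thesis using key[OF b] Sj by force
  next
    case 2
    then have "({f 1, f 3}, {f 0, f 2}) \<in> rects G A B"
      using key[OF bipartition_sym[OF b]] by (auto simp: rects_def insert_commute)
    then show ?thesis using Sj join_commute by force
  qed
qed (use rects_subset_copies_C4[OF b] in auto)

text \<open>Intersecting the vertex set of a join with the two parts recovers the diagonals, so
  different pairs give different cycles.\<close>

lemma card_copies_C4_bipartition:
  assumes b: "bipartition G A B"
  shows "card (copies (cycle_graph 4) G) = card (rects G A B)"
proof -
  have "inj_on (\<lambda>(X, Y). join X Y) (rects G A B)"
  proof (rule inj_on_inverseI)
    fix p assume "p \<in> rects G A B"
    then show "(\<lambda>S. (verts S \<inter> A, verts S \<inter> B)) ((\<lambda>(X, Y). join X Y) p) = p"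
      using b unfolding bipartition_def rects_def join_def by auto
  qed
  then show ?thesis using copies_C4_bipartition[OF b] by (simp add: card_image)
qed

section \<open>Counting 4-cycles\<close>

text \<open>The 6-cycle would be \<open>x u y v z w\<close>. Being neighbours of vertices of
  \<open>A\<close>, \<open>u\<close>, \<open>v\<close>, \<open>w\<close> lie in \<open>B\<close> and
  so differ from \<open>x\<close>, \<open>y\<close>, \<open>z\<close>. Thus the three pairs from
  \<open>x\<close>, \<open>y\<close>, \<open>z\<close> have no distinct representatives among their
  common neighbours.\<close>

lemma C6_free_bipartition:
  assumes b: "bipartition G A B" and free: "free_of (cycle_graph 6) G"
    and a: "x \<in> A" "y \<in> A" "z \<in> A" "x \<noteq> y" "x \<noteq> z" "y \<noteq> z"
    and ne: "u \<noteq> v" "u \<noteq> w" "v \<noteq> w"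
    and e: "{x, u} \<in> edges G" "{y, u} \<in> edges G" "{y, v} \<in> edges G" "{z, v} \<in> edges G"
      "{z, w} \<in> edges G" "{x, w} \<in> edges G"
  shows False
proof -
  have B: "u \<in> B" "v \<in> B" "w \<in> B"
    using bipartition_nbr[OF b] a e by blast+
  have ne': "x \<noteq> u" "x \<noteq> v" "x \<noteq> w" "y \<noteq> u" "y \<noteq> v" "y \<noteq> w" "z \<noteq> u" "z \<noteq> v" "z \<noteq> w"
    using b a B by (auto simp: bipartition_def)
  define f :: "nat \<Rightarrow> 'a" where "f i = [x, u, y, v, z, w] ! i" for i
  have f: "f 0 = x" "f 1 = u" "f (Suc 0) = u" "f 2 = y" "f 3 = v" "f 4 = z" "f 5 = w"
    by (simp_all add: f_def eval_nat_numeral)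
  have "inj_on f (verts (cycle_graph 6))"
    using a ne ne' by (auto simp: verts_cycle_graph_6 f)
  moreover have "f ` verts (cycle_graph 6) \<subseteq> verts G"
    using a B b by (auto simp: verts_cycle_graph_6 f bipartition_def)
  moreover have "(`) f ` edges (cycle_graph 6) \<subseteq> edges G"
    unfolding edges_cycle_graph_6 using e by (auto simp: f insert_commute)
  moreover have "simple_graph G" using b by (simp add: bipartition_def)
  ultimately have "copies (cycle_graph 6) G \<noteq> {}"
    unfolding copies_eq[OF simple_graph_cycle_graph_6 \<open>simple_graph G\<close>] by blast
  with free show False by (simp add: free_of_def)
qed

lemma rect_diagonal_codeg_2:
  assumes b: "bipartition G A B" and free: "free_of (cycle_graph 6) G"
    and r: "(X, Y) \<in> rects G A B"
  shows "Y = common_nbrs G X \<or> X = common_nbrs G Y"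
proof (rule ccontr)
  assume *: "\<not> ?thesis"
  \<comment> \<open>These inclusions hold for every rectangle, so if both equalities fail, each
    diagonal has a further common neighbour.\<close>
  have sub: "Y \<subseteq> common_nbrs G X" "X \<subseteq> common_nbrs G Y"
    using r unfolding rects_def common_nbrs_def by (auto, metis insert_commute)
  obtain v where v: "v \<in> common_nbrs G X" "v \<notin> Y" using * sub by blast
  obtain z where z: "z \<in> common_nbrs G Y" "z \<notin> X" using * sub by blast
  obtain x x' where X: "X = {x, x'}" "x \<noteq> x'" using r by (auto simp: rects_def card_2_iff)
  obtain y y' where Y: "Y = {y, y'}" "y \<noteq> y'" using r by (auto simp: rects_def card_2_iff)
  have "z \<in> A"
    using common_nbrs_subset[OF bipartition_sym[OF b], of Y] r z Y by (auto simp: rects_def)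
  moreover have "x \<in> A" "x' \<in> A" using r X by (auto simp: rects_def)
  \<comment> \<open>The forbidden 6-cycle is \<open>x v x' y' z y\<close>.\<close>
  ultimately show False
    using C6_free_bipartition[OF b free, of x x' z v y' y] X Y v z r
    by (auto simp: rects_def common_nbrs_def insert_commute)
qed

text \<open>A diagonal of codegree 2 determines the other diagonal as its set of common neighbours.
  The images \<open>?U\<close> and \<open>?V\<close> may overlap, when both diagonals have codegree
  2; a covering suffices for the bound.\<close>

lemma card_rects_le_pairs:
  assumes b: "bipartition G A B" and free: "free_of (cycle_graph 6) G"
  shows "card (rects G A B) \<le> card (pairs_codeg_2 G A) + card (pairs_codeg_2 G B)"
proof -
  let ?U = "(\<lambda>X. (X, common_nbrs G X)) ` pairs_codeg_2 G A"
  let ?V = "(\<lambda>Y. (common_nbrs G Y, Y)) ` pairs_codeg_2 G B"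
  have fin: "finite (pairs_codeg_2 G A)" "finite (pairs_codeg_2 G B)"
    using bipartition_finite[OF b] by (auto simp: pairs_codeg_2_def)
  have "rects G A B \<subseteq> ?U \<union> ?V"
  proof
    fix p assume "p \<in> rects G A B"
    then obtain X Y where p: "p = (X, Y)" "(X, Y) \<in> rects G A B" by (cases p) auto
    then have "X \<subseteq> A" "Y \<subseteq> B" "card X = 2" "card Y = 2" by (auto simp: rects_def)
    then show "p \<in> ?U \<union> ?V"
      using rect_diagonal_codeg_2[OF b free p(2)] p(1) by (auto simp: pairs_codeg_2_def)
  qed
  then have "card (rects G A B) \<le> card (?U \<union> ?V)" using fin by (intro card_mono) auto
  also have "\<dots> \<le> card ?U + card ?V" by (rule card_Un_le)
  also have "\<dots> \<le> card (pairs_codeg_2 G A) + card (pairs_codeg_2 G B)"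
    using fin by (intro add_mono card_image_le)
  finally show ?thesis .
qed

text \<open>The pair \<open>Y\<close> is the common neighbourhood shared by the three pairs of a
  triple \<open>T\<close> in \<open>A\<close>; all of \<open>T\<close> is adjacent to it, so its
  codegree is at least 3.\<close>

lemma ex_pair_codeg_not_2:
  assumes b: "bipartition G A B" and free: "free_of (cycle_graph 6) G" and "card A \<ge> 3"
    and codeg: "\<And>X. X \<subseteq> A \<Longrightarrow> card X = 2 \<Longrightarrow> card (common_nbrs G X) = 2"
  obtains Y where "Y \<subseteq> B" "card Y = 2" "card (common_nbrs G Y) \<noteq> 2"
proof -
  obtain T where T: "T \<subseteq> A" "card T = 3" using obtain_subset_with_card_n[OF \<open>card A \<ge> 3\<close>] .
  then obtain x y z where t: "T = {x, y, z}" "x \<noteq> y" "x \<noteq> z" "y \<noteq> z"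
    unfolding card_3_iff by blast
  then have A: "x \<in> A" "y \<in> A" "z \<in> A" using T by auto
  let ?P = "common_nbrs G {x, y}" and ?Q = "common_nbrs G {y, z}" and ?R = "common_nbrs G {x, z}"
  have c: "card ?P = 2" "card ?Q = 2" "card ?R = 2" using codeg A t by auto
  have fin: "finite ?P" "finite ?Q" "finite ?R" using c by (intro card_ge_0_finite; simp)+
  have "?P = ?R"
  proof (rule ccontr)
    assume "?P \<noteq> ?R"
    \<comment> \<open>Equal finite cardinalities turn inequality into non-inclusion. With
      \<open>u\<close> outside \<open>?R\<close>, only \<open>v \<noteq> u\<close> and
      \<open>w \<noteq> v\<close> must be arranged; \<open>u \<noteq> w\<close> is then
      automatic.\<close>
    then have "\<not> ?P \<subseteq> ?R" using card_subset_eq[OF fin(3), of ?P] c by auto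
    then obtain u where u: "u \<in> ?P" "u \<notin> ?R" by blast
    have "\<not> ?Q \<subseteq> {u}" using card_mono[of "{u}" ?Q] c by auto
    then obtain v where v: "v \<in> ?Q" "v \<noteq> u" by blast
    have "\<not> ?R \<subseteq> {v}" using card_mono[of "{v}" ?R] c by auto
    then obtain w where w: "w \<in> ?R" "w \<noteq> v" by blast
    have "u \<noteq> w" using u w by blast
    moreover have "{x, u} \<in> edges G" "{y, u} \<in> edges G" "{y, v} \<in> edges G" "{z, v} \<in> edges G"
      "{z, w} \<in> edges G" "{x, w} \<in> edges G"
      using u v w by (simp_all add: common_nbrs_def)
    ultimately show False
      using C6_free_bipartition[OF b free A t(2-4), of u v w] v w by metis
  qed
  have "{v, w} \<in> edges G" if "w \<in> T" "v \<in> ?P" for v w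
  proof -
    have "v \<in> ?R" using that \<open>?P = ?R\<close> by blast
    with that t(1) show ?thesis by (auto simp: common_nbrs_def insert_commute)
  qed
  then have "T \<subseteq> common_nbrs G ?P"
    unfolding common_nbrs_def[of _ ?P] by blast
  moreover have "?P \<subseteq> B" using A by (intro common_nbrs_subset[OF b]) auto
  moreover have "finite (common_nbrs G ?P)"
  proof -
    have "?P \<noteq> {}" using c by auto
    then have "common_nbrs G ?P \<subseteq> A"
      by (rule common_nbrs_subset[OF bipartition_sym[OF b] \<open>?P \<subseteq> B\<close>])
    then show ?thesis using bipartition_finite[OF b] finite_subset by blast
  qed
  ultimately have "card T \<le> card (common_nbrs G ?P)" by (simp add: card_mono)
  then show ?thesis using that[of ?P] \<open>?P \<subseteq> B\<close> c T by simp
qed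

text \<open>For \<open>p = x + 3\<close> and \<open>q = y + 3\<close> the right side exceeds the
  left by \<open>x * y + x + y\<close>. Equality at \<open>p = q = 3\<close> means that strictness
  in \<open>card_rects_less\<close> must come from the count of pairs.\<close>

lemma choose_2_add_le:
  assumes "p \<ge> 3" "q \<ge> 3"
  shows "(p choose 2) + (q choose 2) \<le> (p + q - 2) choose 2"
proof -
  obtain x y where "p = x + 3" "q = y + 3" using assms by (metis add.commute le_Suc_ex)
  then have "p * (p - 1) + q * (q - 1) \<le> (p + q - 2) * (p + q - 2 - 1)"
    by (simp add: algebra_simps)
  moreover have "2 * (m choose 2) = m * (m - 1)" for m :: nat
    by (simp add: choose_two algebra_simps)
  ultimately have "2 * ((p choose 2) + (q choose 2)) \<le> 2 * ((p + q - 2) choose 2)"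
    by (simp only: distrib_left)
  then show ?thesis by simp
qed

lemma card_rects_less:
  assumes b: "bipartition G A B" and free: "free_of (cycle_graph 6) G"
    and AB: "card A \<ge> 3" "card B \<ge> 3"
  shows "card (rects G A B) < (card A + card B - 2) choose 2"
proof -
  let ?pairs = "\<lambda>C. {X. X \<subseteq> C \<and> card X = 2}"
  note fin = bipartition_finite[OF b]
  have sub: "pairs_codeg_2 G C \<subseteq> ?pairs C" for C by (auto simp: pairs_codeg_2_def)
  have finp: "finite (?pairs A)" "finite (?pairs B)" using fin by auto
  \<comment> \<open>If every pair in \<open>B\<close> has codegree 2, then \<open>A\<close> contains
    a pair that does not, by \<open>ex_pair_codeg_not_2\<close> with the parts exchanged.\<close>
  have "pairs_codeg_2 G A \<noteq> ?pairs A \<or> pairs_codeg_2 G B \<noteq> ?pairs B"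
  proof (rule disjCI)
    assume "\<not> pairs_codeg_2 G B \<noteq> ?pairs B"
    then have *: "\<And>Y. Y \<subseteq> B \<Longrightarrow> card Y = 2 \<Longrightarrow> card (common_nbrs G Y) = 2"
      by (auto simp: pairs_codeg_2_def)
    show "pairs_codeg_2 G A \<noteq> ?pairs A"
      by (rule ex_pair_codeg_not_2[OF bipartition_sym[OF b] free AB(2) *])
        (auto simp: pairs_codeg_2_def)
  qed
  then have "card (pairs_codeg_2 G A) < card (?pairs A) \<or> card (pairs_codeg_2 G B) < card (?pairs B)"
    using psubset_card_mono[OF finp(1), of "pairs_codeg_2 G A"]
      psubset_card_mono[OF finp(2), of "pairs_codeg_2 G B"] sub[of A] sub[of B] by blast
  then have "card (pairs_codeg_2 G A) + card (pairs_codeg_2 G B) < card (?pairs A) + card (?pairs B)"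
    using card_mono[OF finp(1) sub] card_mono[OF finp(2) sub] by linarith
  also have "\<dots> = (card A choose 2) + (card B choose 2)" using fin by (simp add: n_subsets)
  also have "\<dots> \<le> (card A + card B - 2) choose 2" using AB by (rule choose_2_add_le)
  finally show ?thesis using card_rects_le_pairs[OF b free] by simp
qed

section \<open>A part with at most two vertices, and the resulting bound\<close>

lemma card_rects_part_2:
  assumes b: "bipartition G A B" and A: "card A = 2"
  shows "card (rects G A B) = card (common_nbrs G A) choose 2"
proof -
  have ss: "common_nbrs G A \<subseteq> B" using common_nbrs_subset[OF b] A by fastforce
  have "X = A" if "X \<subseteq> A" "card X = 2" for X
    using card_subset_eq[OF bipartition_finite(1)[OF b]] that A by simp
  then have "rects G A B = Pair A ` {Y. Y \<subseteq> common_nbrs G A \<and> card Y = 2}"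
    using ss A by (fastforce simp: rects_def common_nbrs_def)
  then have "card (rects G A B) = card {Y. Y \<subseteq> common_nbrs G A \<and> card Y = 2}"
    by (simp add: card_image inj_on_def)
  also have "\<dots> = card (common_nbrs G A) choose 2"
    using ss bipartition_finite(2)[OF b] by (simp add: n_subsets finite_subset)
  finally show ?thesis .
qed

lemma rects_part_le_1:
  assumes "bipartition G A B" "card A \<le> 1"
  shows "rects G A B = {}"
proof -
  have "card X \<noteq> 2" if "X \<subseteq> A" for X
    using card_mono[OF bipartition_finite(1)[OF assms(1)] that] assms(2) by simp
  then show ?thesis by (auto simp: rects_def)
qed

lemma choose_2_mono: "k \<le> m \<Longrightarrow> k choose 2 \<le> m choose 2" for k m :: nat
  unfolding choose_two by (intro div_le_mono mult_le_mono) auto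

lemma choose_2_less:
  assumes "k < m" "2 \<le> m"
  shows "k choose 2 < m choose 2"
proof -
  \<comment> \<open>By Pascal's rule \<open>Suc m' choose 2\<close> is
    \<open>m' + (m' choose 2)\<close>, which is a strict increase because
    \<open>m' \<ge> 1\<close>.\<close>
  obtain m' where m': "m = Suc m'" "k \<le> m'" "1 \<le> m'" using assms by (cases m) auto
  then show ?thesis using choose_2_mono[of k m'] by (simp add: numeral_2_eq_2)
qed

text \<open>Equality forces every vertex of \<open>B\<close> to be a common neighbour of
  \<open>A\<close>. This needs \<open>card B \<ge> 2\<close>: for smaller \<open>B\<close> the count
  is 0 even when edges are missing.\<close>

lemma card_copies_C4_part_2:
  assumes b: "bipartition G A B" and A: "card A = 2"
  shows "card (copies (cycle_graph 4) G) \<le> card B choose 2"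
    and "card (copies (cycle_graph 4) G) = card B choose 2 \<Longrightarrow> card B \<ge> 2 \<Longrightarrow> G = join A B"
proof -
  let ?N = "common_nbrs G A"
  have N: "?N \<subseteq> B" using common_nbrs_subset[OF b] A by fastforce
  note fin = bipartition_finite(2)[OF b]
  have c: "card (copies (cycle_graph 4) G) = card ?N choose 2"
    using card_copies_C4_bipartition[OF b] card_rects_part_2[OF b A] by simp
  have le: "card ?N \<le> card B" using N fin by (rule card_mono[rotated])
  then show "card (copies (cycle_graph 4) G) \<le> card B choose 2" using c by (simp add: choose_2_mono)
  assume "card (copies (cycle_graph 4) G) = card B choose 2" "card B \<ge> 2"
  then have "card ?N = card B" using choose_2_less[of "card ?N" "card B"] c le by fastforce
  then have "?N = B" using card_subset_eq[OF fin N] by simp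
  then have nbr: "{x, y} \<in> edges G" if "x \<in> A" "y \<in> B" for x y
    using that unfolding common_nbrs_def by blast
  have "e \<in> edges G \<longleftrightarrow> (\<exists>x y. e = {x, y} \<and> x \<in> A \<and> y \<in> B)" for e
    using b nbr unfolding bipartition_def by metis
  then have "edges G = edges (join A B)" by (auto simp: join_def)
  moreover have "verts G = verts (join A B)" using b by (simp add: bipartition_def join_def)
  ultimately show "G = join A B" by (intro prod_eqI)
qed

text \<open>The cases follow the size of the smaller part. Only size 2 can reach the bound once
  \<open>n \<ge> 4\<close>: size at most 1 gives no 4-cycle while the bound is positive, and size at
  least 3 gives strict inequality.\<close>

lemma bip_free_graph_C4_bound:
  assumes G: "bip_free_graph n (cycle_graph 6) G"
  shows "card (copies (cycle_graph 4) G) \<le> (n - 2) choose 2 \<and>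
    (n \<ge> 4 \<longrightarrow> card (copies (cycle_graph 4) G) = (n - 2) choose 2 \<longrightarrow>
      (\<exists>A B. bipartition G A B \<and> card A = 2 \<and> card B = n - 2 \<and> G = join A B))"
proof -
  have free: "free_of (cycle_graph 6) G" using G by (simp add: bip_free_graph_def)
  obtain C D where "bipartition G C D" using G by (auto simp: bip_free_graph_def bipartite_def bipartition_def)
  then obtain A B where b: "bipartition G A B" and le: "card A \<le> card B"
    using bipartition_sym[of G] by (metis nle_le)
  have n: "n = card A + card B" using bipartition_card[OF b] G by (simp add: bip_free_graph_def)
  note c = card_copies_C4_bipartition[OF b]
  consider "card A \<le> 1" | "card A = 2" | "card A \<ge> 3" by linarith
  then show ?thesis
  proof cases
    case 1
    then have "card (copies (cycle_graph 4) G) = 0" using c rects_part_le_1[OF b] by simp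
    moreover have "(n - 2) choose 2 > 0" if "n \<ge> 4" using that by simp
    ultimately show ?thesis by fastforce
  next
    case 2
    then show ?thesis using card_copies_C4_part_2[OF b 2] b n by auto
  next
    case 3
    then show ?thesis using card_rects_less[OF b free 3] le c n by simp
  qed
qed

section \<open>Complete bipartite graphs\<close>

lemma simple_graph_join:
  assumes "finite A" "finite B" "A \<inter> B = {}"
  shows "simple_graph (join A B)"
proof -
  have "x \<noteq> y" if "x \<in> A" "y \<in> B" for x y using assms that by blast
  then show ?thesis using assms by (auto simp: simple_graph_def join_def)
qed

lemma bipartition_join:
  assumes "finite A" "finite B" "A \<inter> B = {}"
  shows "bipartition (join A B) A B"
  using simple_graph_join[OF assms] assms by (auto simp: bipartition_def join_def)

lemma complete_bipartite_eq_join: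
  "complete_bipartite p q = join (Inl ` {..<p}) (Inr ` {..<q})"
  by (auto simp: complete_bipartite_def join_def)

text \<open>This translates between isomorphism with the concrete graph on a sum type and the joins
  in which the extremal results are phrased.\<close>

lemma isomorphic_complete_bipartite_iff:
  assumes G: "simple_graph G"
  shows "isomorphic G (complete_bipartite p q) \<longleftrightarrow>
    (\<exists>A B. finite A \<and> finite B \<and> A \<inter> B = {} \<and> card A = p \<and> card B = q \<and> G = join A B)"
    (is "?L \<longleftrightarrow> ?R")
proof
  assume ?L
  then obtain f where f: "bij_betw f (verts G) (verts (complete_bipartite p q))"
    and adj: "\<And>u v. u \<in> verts G \<Longrightarrow> v \<in> verts G \<Longrightarrow>
      {u, v} \<in> edges G \<longleftrightarrow> {f u, f v} \<in> edges (complete_bipartite p q)"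
    unfolding isomorphic_def by blast
  \<comment> \<open>The parts are pulled back along \<open>f\<close> from the two summands.\<close>
  define A where "A = verts G \<inter> f -` Inl ` {..<p}"
  define B where "B = verts G \<inter> f -` Inr ` {..<q}"
  have inj: "inj_on f (verts G)" and im: "f ` verts G = Inl ` {..<p} \<union> Inr ` {..<q}"
    using f by (simp_all add: bij_betw_def complete_bipartite_def Plus_def)
  have "f ` A = f ` verts G \<inter> Inl ` {..<p}" "f ` B = f ` verts G \<inter> Inr ` {..<q}"
    unfolding A_def B_def by auto
  then have fA: "f ` A = Inl ` {..<p}" and fB: "f ` B = Inr ` {..<q}"
    unfolding im by auto
  have "v \<in> A \<or> v \<in> B" if "v \<in> verts G" for v
  proof -
    have "f v \<in> Inl ` {..<p} \<union> Inr ` {..<q}"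
      using that unfolding im[symmetric] by (rule imageI)
    then show ?thesis using that by (simp add: A_def B_def)
  qed
  moreover have "A \<subseteq> verts G" "B \<subseteq> verts G" by (simp_all add: A_def B_def)
  ultimately have V: "verts G = A \<union> B" by blast
  have "card (f ` A) = card A" "card (f ` B) = card B"
    by (rule card_image, rule inj_on_subset[OF inj], simp add: A_def B_def)+
  then have card: "card A = p" "card B = q" unfolding fA fB by (simp_all add: card_image[OF inj_Inl] card_image[OF inj_Inr])
  have disj: "A \<inter> B = {}" by (auto simp: A_def B_def)
  have fin: "finite A" "finite B" using G V by (auto simp: simple_graph_def)
  have edge: "{u, v} \<in> edges G \<longleftrightarrow> u \<in> A \<and> v \<in> B \<or> u \<in> B \<and> v \<in> A"
    if "u \<in> verts G" "v \<in> verts G" for u v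
    unfolding adj[OF that] using that
    by (auto simp: complete_bipartite_def A_def B_def doubleton_eq_iff)
  have "edges G = {{x, y} | x y. x \<in> A \<and> y \<in> B}"
  proof (intro equalityI subsetI)
    fix e assume e: "e \<in> edges G"
    then obtain u v where uv: "e = {u, v}" "u \<in> verts G" "v \<in> verts G"
      using G by (fastforce simp: simple_graph_def card_2_iff)
    then show "e \<in> {{x, y} | x y. x \<in> A \<and> y \<in> B}" using edge e by (auto simp: insert_commute)
  qed (use edge V in auto)
  then have "G = join A B" using V by (simp add: join_def prod_eqI)
  then show ?R using fin disj card by blast
next
  assume ?R
  then obtain A B where *: "finite A" "finite B" "A \<inter> B = {}" "card A = p" "card B = q" "G = join A B"
    by blast
  then obtain g h where g: "bij_betw g A {..<p}" and h: "bij_betw h B {..<q}"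
    by (metis ex_bij_betw_finite_nat lessThan_atLeast0)
  define f where "f v = (if v \<in> A then Inl (g v) else Inr (h v))" for v
  have fA: "f v = Inl (g v)" "g v < p" if "v \<in> A" for v
    using that bij_betwE[OF g] by (auto simp: f_def)
  have fB: "f v = Inr (h v)" "h v < q" if "v \<in> B" for v
    using that *(3) bij_betwE[OF h] by (auto simp: f_def)
  have "bij_betw (Inl \<circ> g) A (Inl ` {..<p})"
    by (rule bij_betw_trans[OF g]) (simp add: bij_betw_def)
  then have bA: "bij_betw f A (Inl ` {..<p})"
    using fA by (subst bij_betw_cong[of A f "Inl \<circ> g"]) simp_all
  have "bij_betw (Inr \<circ> h) B (Inr ` {..<q})"
    by (rule bij_betw_trans[OF h]) (simp add: bij_betw_def)
  then have bB: "bij_betw f B (Inr ` {..<q})"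
    using fB by (subst bij_betw_cong[of B f "Inr \<circ> h"]) simp_all
  have "bij_betw f (verts G) (verts (complete_bipartite p q))"
    using bij_betw_combine[OF bA bB] *
    by (auto simp: join_def complete_bipartite_eq_join)
  moreover have "{u, v} \<in> edges G \<longleftrightarrow> {f u, f v} \<in> edges (complete_bipartite p q)"
    if "u \<in> verts G" "v \<in> verts G" for u v
  proof -
    have "{u, v} \<in> edges G \<longleftrightarrow> u \<in> A \<and> v \<in> B \<or> u \<in> B \<and> v \<in> A"
      unfolding * join_def by (auto simp: doubleton_eq_iff)
    also have "\<dots> \<longleftrightarrow> {f u, f v} \<in> edges (complete_bipartite p q)"
      using that * fA fB by (auto simp: join_def complete_bipartite_def doubleton_eq_iff)
    finally show ?thesis .
  qed
  ultimately show ?L unfolding isomorphic_def by blast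
qed

text \<open>The edges \<open>01\<close>, \<open>23\<close>, \<open>45\<close> of a 6-cycle are disjoint, so they would need three vertices in \<open>A\<close>.\<close>

lemma free_of_C6_join:
  assumes fin: "finite A" "finite B" "A \<inter> B = {}" and A: "card A \<le> 2"
  shows "free_of (cycle_graph 6) (join A B)"
proof (rule ccontr)
  assume "\<not> ?thesis"
  then obtain f where inj: "inj_on f (verts (cycle_graph 6))"
    and "(`) f ` edges (cycle_graph 6) \<subseteq> edges (join A B)"
    unfolding free_of_def copies_eq[OF simple_graph_cycle_graph_6 simple_graph_join[OF fin]] by blast
  then have "{f 0, f 1} \<in> edges (join A B)" "{f 2, f 3} \<in> edges (join A B)"
    "{f 4, f 5} \<in> edges (join A B)"
    unfolding edges_cycle_graph_6 by auto
  then have "f 0 \<in> A \<or> f 1 \<in> A" "f 2 \<in> A \<or> f 3 \<in> A" "f 4 \<in> A \<or> f 5 \<in> A"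
    by (auto simp: join_def doubleton_eq_iff)
  then obtain i j k where ijk: "i \<in> {0, 1}" "j \<in> {2, 3}" "k \<in> {4, 5}" "{f i, f j, f k} \<subseteq> A"
    by blast
  then have "{i, j, k} \<subseteq> verts (cycle_graph 6)" "i \<noteq> j" "i \<noteq> k" "j \<noteq> k"
    unfolding verts_cycle_graph_6 by auto
  then have "card {i, j, k} = 3" by simp
  then have "card (f ` {i, j, k}) = 3"
    using card_image[OF inj_on_subset[OF inj \<open>{i, j, k} \<subseteq> verts (cycle_graph 6)\<close>]] by simp
  moreover have "card (f ` {i, j, k}) \<le> card A" using ijk(4) fin by (intro card_mono) simp_all
  ultimately show False using A by simp
qed

lemma join_2_extremal:
  assumes fin: "finite A" "finite B" "A \<inter> B = {}" and A: "card A = 2"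
  shows "bip_free_graph (card B + 2) (cycle_graph 6) (join A B)"
    and "card (copies (cycle_graph 4) (join A B)) = card B choose 2"
proof -
  note b = bipartition_join[OF fin]
  show "bip_free_graph (card B + 2) (cycle_graph 6) (join A B)"
    using b bipartition_card[OF b] free_of_C6_join[OF fin] A
    by (auto simp: bip_free_graph_def bipartite_def bipartition_def)
  have "A \<noteq> {}" using A by auto
  then have "common_nbrs (join A B) A \<subseteq> B" by (intro common_nbrs_subset[OF b]) simp_all
  moreover have "B \<subseteq> common_nbrs (join A B) A" by (auto simp: common_nbrs_def join_def)
  ultimately have "common_nbrs (join A B) A = B" by blast
  then show "card (copies (cycle_graph 4) (join A B)) = card B choose 2"
    using card_copies_C4_bipartition[OF b] card_rects_part_2[OF b A] by simp
qed

section \<open>The extremal number and the extremal graph\<close>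

lemma ex_bip_C4_C6:
  assumes "n \<ge> 1"
  shows "ex_bip n (cycle_graph 4) (cycle_graph 6) = (n - 2) choose 2"
proof -
  let ?M = "{card (copies (cycle_graph 4) G) | G :: nat sgraph. bip_free_graph n (cycle_graph 6) G}"
  have le: "m \<le> (n - 2) choose 2" if "m \<in> ?M" for m using that bip_free_graph_C4_bound by blast
  \<comment> \<open>The upper bound also yields the finiteness on which \<open>Max\<close>
    depends.\<close>
  then have "finite ?M" by (meson finite_nat_set_iff_bounded_le)
  moreover have "(n - 2) choose 2 \<in> ?M"
  proof (cases "n \<ge> 2")
    case True
    let ?G = "join {..<2::nat} {2..<n}"
    have "bip_free_graph (card {2..<n} + 2) (cycle_graph 6) ?G"
      "card (copies (cycle_graph 4) ?G) = card {2..<n} choose 2"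
      by (intro join_2_extremal; auto)+
    moreover have "card {2..<n} = n - 2" "n - 2 + 2 = n" using True by simp_all
    ultimately have "bip_free_graph n (cycle_graph 6) ?G"
      "card (copies (cycle_graph 4) ?G) = (n - 2) choose 2"
      by metis+
    then show ?thesis by (metis (mono_tags, lifting) mem_Collect_eq)
  next
    case False
    \<comment> \<open>Here \<open>n - 2\<close> truncates to 0, so the value is 0, and a single
      vertex attains it.\<close>
    then have n: "n = 1" using assms by simp
    let ?G = "join {0::nat} {}"
    have b: "bipartition ?G {0} {}" by (rule bipartition_join) auto
    have "bip_free_graph n (cycle_graph 6) ?G"
      using b bipartition_card[OF b] free_of_C6_join[of "{0::nat}" "{}"] n
      by (auto simp: bip_free_graph_def bipartite_def bipartition_def)
    moreover have "card (copies (cycle_graph 4) ?G) = (n - 2) choose 2"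
      using card_copies_C4_bipartition[OF b] rects_part_le_1[OF b] n by simp
    ultimately show ?thesis by (metis (mono_tags, lifting) mem_Collect_eq)
  qed
  ultimately show ?thesis unfolding ex_bip_def using le by (intro Max_eqI) auto
qed

text \<open>The maximum ranges over graphs on \<open>nat\<close>, the other clauses over any vertex
  type; they are linked through the common value, since the bound and the construction hold over
  every type. For \<open>n \<le> 3\<close> the maximum is 0 and every bipartite graph on
  \<open>n\<close> vertices attains it, so uniqueness starts at 4.\<close>

theorem theorem1:
  fixes n :: nat
  assumes "n \<ge> 1"
  shows "ex_bip n (cycle_graph 4) (cycle_graph 6) = (n - 2) choose 2 \<and>
    (n \<ge> 2 \<longrightarrow> (\<forall>G :: 'a sgraph. simple_graph G \<and> isomorphic G (complete_bipartite 2 (n - 2)) \<longrightarrow>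
        bip_free_graph n (cycle_graph 6) G \<and>
        card (copies (cycle_graph 4) G) = ex_bip n (cycle_graph 4) (cycle_graph 6))) \<and>
    (n \<ge> 4 \<longrightarrow> (\<forall>G :: 'a sgraph. bip_free_graph n (cycle_graph 6) G \<and>
        card (copies (cycle_graph 4) G) = ex_bip n (cycle_graph 4) (cycle_graph 6) \<longrightarrow>
        isomorphic G (complete_bipartite 2 (n - 2))))"
  unfolding ex_bip_C4_C6[OF assms]
proof (intro conjI impI allI; (elim conjE)?)
  fix G :: "'a sgraph"
  assume n: "n \<ge> 2" and G: "simple_graph G" "isomorphic G (complete_bipartite 2 (n - 2))"
  obtain A B where AB: "finite A" "finite B" "A \<inter> B = {}" "card A = 2" "card B = n - 2"
    "G = join A B"
    using G(2) unfolding isomorphic_complete_bipartite_iff[OF G(1)] by blast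
  have "card B + 2 = n" using AB(5) n by simp
  then show "bip_free_graph n (cycle_graph 6) G" "card (copies (cycle_graph 4) G) = (n - 2) choose 2"
    using join_2_extremal[OF AB(1-4)] AB(5,6) by metis+
next
  fix G :: "'a sgraph"
  assume n: "n \<ge> 4" and G: "bip_free_graph n (cycle_graph 6) G"
    "card (copies (cycle_graph 4) G) = (n - 2) choose 2"
  obtain A B where AB: "bipartition G A B" "card A = 2" "card B = n - 2" "G = join A B"
    using bip_free_graph_C4_bound[OF G(1)] n G(2) by blast
  have "A \<inter> B = {}" and G': "simple_graph G" using AB(1) by (simp_all add: bipartition_def)
  then show "isomorphic G (complete_bipartite 2 (n - 2))"
    unfolding isomorphic_complete_bipartite_iff[OF G'] using AB bipartition_finite[OF AB(1)] by blast
qed simp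

end
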